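(* Let $p\in[0,1]$ and let $V_n(p)$ be the value of the random game $G_n(p)$. Let $\varphi=\frac{\sqrt5-1}{2}$. Then: \begin{itemize} \item If $p>\varphi$, then $\lim_{n\to\infty}\Pr[V_n(p)=1]=1$. \item If $p<\varphi$, then $\lim_{n\to\infty}\Pr[V_n(p)=0]=1$. \item If $p=\varphi$, the starting player wins with probability $\varphi$, i.e. for all integers $n\ge 0$, $\Pr[V_{2n}(\varphi)=1]=\Pr[V_{2n+1}(\varphi)=0]=\varphi$. \end{itemize}
   Context: For an integer $n\ge 0$, consider the complete binary tree of depth $n$ (with $2^n$ leaves). A node has height $h$ if its distance to the leaves below it is $h$ (leaves have height $0$, the root has height $n$). A game of depth $n$ is an assignment of payoffs in $\{0,1\}$ to the leaves, i.e. an element of $\{0,1\}^{2^n}$. Two players move alternately from the root down to a leaf, choosing a child at each step: Player 2 acts at the internal nodes of odd height and Player 1 at the internal nodes of even height (so Player 2 moves last; the starting player is Player 1 if $n$ is even and Player 2 if $n$ is odd, and for $n=0$ this convention names Player 1). Player 1 wins if the payoff of the reached leaf is $1$, and Player 2 wins if it is $0$. The game has complete information, and its value in $\{0,1\}$ is given by backward induction: the value of a leaf is its payoff, the value of an internal node of odd height is the minimum of the values of its two children, the value of an internal node of even height is the maximum of the values of its two children, and the value of the game is the value of the root. The player who wins the game is Player 1 if the value is $1$ and Player 2 if the value is $0$. For $p\in[0,1]$, $G_n(p)\in\{0,1\}^{2^n}$ is the random game whose leaf payoffs are i.i.d. Bernoulli, equal to $1$ with probability $p$ and $0$ with probability $1-p$;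 $V_n(p)$ is the (random) value of $G_n(p)$. *)

theory Defs
  imports "HOL-Probability.Product_PMF"
begin

datatype player = Player1 | Player2

(* the player who moves at a node of height h, for h > 0;
   for h = 0 nobody moves and the value only fixes the convention
   that the depth-0 game is said to be started by Player1 *)
definition mover :: "nat \<Rightarrow> player" where
  "mover h = (if even h then Player1 else Player2)"

definition starting_player :: "nat \<Rightarrow> player" where
  "starting_player n = mover n"

(* A game of depth n is a payoff function g, of which only the entries g i with i < 2 ^ n matter:
   leaf i is the i-th leaf from the left.  In the complete binary tree of depth n, the nodes of
   height h are numbered j < 2 ^ (n - h) from left to right, so that the children of node j of
   height Suc h are the nodes 2 * j and 2 * j + 1 of height h. *)
fun node_value :: "(nat \<Rightarrow> nat) \<Rightarrow> nat \<Rightarrow> nat \<Rightarrow> nat" where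
  "node_value g 0 j = g j"
| "node_value g (Suc h) j =
     (case mover (Suc h) of
        Player1 \<Rightarrow> max (node_value g h (2 * j)) (node_value g h (2 * j + 1))
      | Player2 \<Rightarrow> min (node_value g h (2 * j)) (node_value g h (2 * j + 1)))"

definition game_value :: "nat \<Rightarrow> (nat \<Rightarrow> nat) \<Rightarrow> nat" where
  "game_value n g = node_value g n 0"

definition winner :: "nat \<Rightarrow> (nat \<Rightarrow> nat) \<Rightarrow> player" where
  "winner n g = (if game_value n g = 1 then Player1 else Player2)"

(* entries outside the 2 ^ n leaves are constantly 0 (the default value of the product) *)
definition random_game :: "nat \<Rightarrow> real \<Rightarrow> (nat \<Rightarrow> nat) pmf" where
  "random_game n p = Pi_pmf {..<2 ^ n} 0 (\<lambda>_. map_pmf of_bool (bernoulli_pmf p))"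

end

theory Submission
  imports Defs "HOL-Probability.Characteristic_Functions"
begin

text \<open>
  The two subtrees below a node use disjoint sets of leaves, so their values are independent and
  the value of a node of height \<open>h\<close> is Bernoulli of parameter \<open>q h\<close>, where
  \<open>q (h + 1) = (q h)\<^sup>2\<close> when Player 2 moves there and \<open>q (h + 1) = 1 - (1 - q h)\<^sup>2\<close> when
  Player 1 does.
  Two levels iterate \<open>f x = 1 - (1 - x\<^sup>2)\<^sup>2\<close>, for which
  \<open>f x - x = x (1 - x) (x\<^sup>2 + x - 1)\<close>. Its fixed points in the unit interval are
  \<open>0\<close>, \<open>\<phi>\<close> and \<open>1\<close>, and orbits move monotonically away from \<open>\<phi>\<close>.
\<close>

section \<open>Distribution of the value\<close>

fun win_prob :: "real \<Rightarrow> nat \<Rightarrow> real" where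
  "win_prob p 0 = p"
| "win_prob p (Suc h) =
     (if even (Suc h) then 1 - (1 - win_prob p h)\<^sup>2 else (win_prob p h)\<^sup>2)"

lemma win_prob_range: "p \<in> {0..1} \<Longrightarrow> win_prob p h \<in> {0..1}"
  by (induction h) (auto intro: power_le_one)

text \<open>A distribution on Booleans is determined by its mass at \<open>True\<close>, and the
  conjunction is true only at the pair \<open>(True, True)\<close>.\<close>

lemma map_conj_pair_bernoulli:
  assumes "x \<in> {0..1}" "y \<in> {0..1}"
  shows "map_pmf (\<lambda>(a, b). a \<and> b) (pair_pmf (bernoulli_pmf x) (bernoulli_pmf y))
    = bernoulli_pmf (x * y)"
proof -
  have "(\<lambda>(a, b). a \<and> b) -` {True} = {(True, True)}" by auto
  then have "pmf (map_pmf (\<lambda>(a, b). a \<and> b) (pair_pmf (bernoulli_pmf x) (bernoulli_pmf y))) True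
    = x * y"
    using assms by (simp add: pmf_map measure_pmf_single pmf_pair)
  moreover have "x * y \<in> {0..1}"
    using assms by (auto intro: mult_le_one)
  ultimately show ?thesis
    using assms by (intro pmf_eqI) (metis (full_types) pmf_False_conv_True pmf_bernoulli_True atLeastAtMost_iff)
qed

lemma map_Not_bernoulli:
  assumes "x \<in> {0..1}"
  shows "map_pmf Not (bernoulli_pmf x) = bernoulli_pmf (1 - x)"
proof (rule pmf_eqI)
  fix b
  have "Not -` {b} = {\<not> b}" by auto
  then show "pmf (map_pmf Not (bernoulli_pmf x)) b = pmf (bernoulli_pmf (1 - x)) b"
    using assms by (cases b) (simp_all add: pmf_map measure_pmf_single)
qed

text \<open>By De Morgan this reduces to the conjunction of the negated variables.\<close>

lemma map_disj_pair_bernoulli: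
  assumes "x \<in> {0..1}" "y \<in> {0..1}"
  shows "map_pmf (\<lambda>(a, b). a \<or> b) (pair_pmf (bernoulli_pmf x) (bernoulli_pmf y))
    = bernoulli_pmf (1 - (1 - x) * (1 - y))"
proof -
  have "(1 - x) * (1 - y) \<in> {0..1}"
    using assms by (auto intro: mult_le_one)
  then have "bernoulli_pmf (1 - (1 - x) * (1 - y)) = map_pmf Not (bernoulli_pmf ((1 - x) * (1 - y)))"
    by (rule map_Not_bernoulli [symmetric])
  also have "bernoulli_pmf ((1 - x) * (1 - y)) = map_pmf (\<lambda>(a, b). a \<and> b)
      (pair_pmf (map_pmf Not (bernoulli_pmf x)) (map_pmf Not (bernoulli_pmf y)))"
    using assms by (simp add: map_conj_pair_bernoulli map_Not_bernoulli)
  also have "map_pmf Not \<dots> = map_pmf (\<lambda>(a, b). a \<or> b) (pair_pmf (bernoulli_pmf x) (bernoulli_pmf y))"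
    by (simp add: map_pair [symmetric] pmf.map_comp o_def case_prod_unfold)
  finally show ?thesis ..
qed

section \<open>Leaf blocks and independence of sibling subtrees\<close>

definition leaves_below :: "nat \<Rightarrow> nat \<Rightarrow> nat set" where
  "leaves_below h j = {j * 2 ^ h..<Suc j * 2 ^ h}"

lemma leaves_below_Suc:
  "leaves_below (Suc h) j = leaves_below h (2 * j) \<union> leaves_below h (2 * j + 1)"
  by (auto simp: leaves_below_def)

lemma leaves_below_disjoint: "leaves_below h (2 * j) \<inter> leaves_below h (2 * j + 1) = {}"
  by (auto simp: leaves_below_def)

lemma finite_leaves_below: "finite (leaves_below h j)"
  by (simp add: leaves_below_def)

text \<open>This locality makes the values of sibling nodes independent: their leaf blocks are
  disjoint.\<close>

lemma node_value_cong:
  "(\<And>i. i \<in> leaves_below h j \<Longrightarrow> g i = g' i) \<Longrightarrow> node_value g h j = node_value g' h j"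
proof (induction h arbitrary: j)
  case 0
  then show ?case by (simp add: leaves_below_def)
next
  case (Suc h)
  have "node_value g h (2 * j) = node_value g' h (2 * j)"
    "node_value g h (2 * j + 1) = node_value g' h (2 * j + 1)"
    by (intro Suc.IH Suc.prems; simp add: leaves_below_Suc)+
  then show ?case by (simp only: node_value.simps)
qed

text \<open>The node index stays arbitrary in the induction because the hypothesis is applied to
  both children, \<open>2 * j\<close> and \<open>2 * j + 1\<close>.\<close>

lemma map_node_value:
  assumes p: "p \<in> {0..1}"
  shows "map_pmf (\<lambda>g. node_value g h j)
      (Pi_pmf (leaves_below h j) 0 (\<lambda>_. map_pmf of_bool (bernoulli_pmf p)))
    = map_pmf of_bool (bernoulli_pmf (win_prob p h))"
proof (induction h arbitrary: j)
  case 0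
  then show ?case
    by (simp add: leaves_below_def Pi_pmf_singleton pmf.map_comp o_def)
next
  case (Suc h)
  define q where "q = win_prob p h"
  \<comment> \<open>Hiding the choice between \<open>max\<close> and \<open>min\<close> lets the
    independence argument be carried out once for both players.\<close>
  define op where "op a b = (case mover (Suc h) of Player1 \<Rightarrow> max a b | Player2 \<Rightarrow> min a b)" for a b :: nat
  define D where "D A = Pi_pmf A 0 (\<lambda>_::nat. map_pmf (of_bool :: bool \<Rightarrow> nat) (bernoulli_pmf p))" for A
  let ?L = "leaves_below h (2 * j)" and ?R = "leaves_below h (2 * j + 1)"
  let ?B = "bernoulli_pmf q"
  have q: "q \<in> {0..1}"
    using win_prob_range[OF p] by (simp add: q_def)
  \<comment> \<open>\<open>Pi_pmf_union\<close> draws independent payoffs for the two blocks and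
    glues them by this conditional; each child sees only its own half.\<close>
  have glue: "node_value (\<lambda>x. if x \<in> ?L then g x else g' x) h (2 * j) = node_value g h (2 * j)"
    "node_value (\<lambda>x. if x \<in> ?L then g x else g' x) h (2 * j + 1) = node_value g' h (2 * j + 1)" for g g'
    using leaves_below_disjoint[of h j] by (auto intro!: node_value_cong)
  have "map_pmf (\<lambda>g. node_value g (Suc h) j) (D (leaves_below (Suc h) j)) =
      map_pmf (\<lambda>(g, g'). op (node_value g h (2 * j)) (node_value g' h (2 * j + 1)))
        (pair_pmf (D ?L) (D ?R))"
    unfolding D_def leaves_below_Suc
      Pi_pmf_union[OF finite_leaves_below finite_leaves_below leaves_below_disjoint]
    by (simp only: pmf.map_comp o_def case_prod_unfold node_value.simps glue op_def)
  also have "\<dots> = map_pmf (\<lambda>(a, b). op a b)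
      (pair_pmf (map_pmf (\<lambda>g. node_value g h (2 * j)) (D ?L))
        (map_pmf (\<lambda>g. node_value g h (2 * j + 1)) (D ?R)))"
    by (simp add: map_pair [symmetric] pmf.map_comp o_def case_prod_unfold)
  also have "\<dots> = map_pmf (\<lambda>(a, b). op (of_bool a) (of_bool b)) (pair_pmf ?B ?B)"
    unfolding D_def Suc.IH
    by (simp add: map_pair [symmetric] pmf.map_comp o_def case_prod_unfold q_def)
  also have "\<dots> = map_pmf of_bool (bernoulli_pmf (win_prob p (Suc h)))"
  proof (cases "even (Suc h)")
    case True
    \<comment> \<open>On the values 0 and 1, \<open>max\<close> is disjunction; in the other case
      \<open>min\<close> is conjunction.\<close>
    have "(\<lambda>(a, b). op (of_bool a) (of_bool b)) = (of_bool :: bool \<Rightarrow> nat) \<circ> (\<lambda>(a, b). a \<or> b)"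
      using True by (auto simp: op_def mover_def fun_eq_iff)
    then show ?thesis
      using True by (simp add: pmf.map_comp [symmetric] map_disj_pair_bernoulli[OF q q]
        q_def [symmetric] power2_eq_square)
  next
    case False
    have "(\<lambda>(a, b). op (of_bool a) (of_bool b)) = (of_bool :: bool \<Rightarrow> nat) \<circ> (\<lambda>(a, b). a \<and> b)"
      using False by (auto simp: op_def mover_def fun_eq_iff)
    then show ?thesis
      using False by (simp add: pmf.map_comp [symmetric] map_conj_pair_bernoulli[OF q q]
        q_def [symmetric] power2_eq_square)
  qed
  finally show ?case by (simp add: D_def)
qed

lemma map_game_value:
  assumes "p \<in> {0..1}"
  shows "map_pmf (game_value n) (random_game n p) = map_pmf of_bool (bernoulli_pmf (win_prob p n))"
  using map_node_value[OF assms, of n 0]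
  by (simp add: game_value_def[abs_def] random_game_def leaves_below_def lessThan_atLeast0)

text \<open>The third form is there because \<open>winner\<close> names \<open>Player2\<close> for
  every value other than 1.\<close>

lemma prob_game_value:
  assumes "p \<in> {0..1}"
  shows "measure_pmf.prob (random_game n p) {g. game_value n g = 1} = win_prob p n"
    and "measure_pmf.prob (random_game n p) {g. game_value n g = 0} = 1 - win_prob p n"
    and "measure_pmf.prob (random_game n p) {g. game_value n g \<noteq> 1} = 1 - win_prob p n"
proof -
  have *: "measure_pmf.prob (random_game n p) {g. P (game_value n g)} =
      measure_pmf.prob (bernoulli_pmf (win_prob p n)) {b. P (of_bool b)}" for P
  proof -
    have "measure_pmf.prob (random_game n p) {g. P (game_value n g)} =
        measure_pmf.prob (map_pmf (game_value n) (random_game n p)) {v. P v}"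
      by (simp add: vimage_def)
    then show ?thesis
      unfolding map_game_value[OF assms] by (simp add: vimage_def)
  qed
  have sets: "{b. of_bool b = (1::nat)} = {True}" "{b. of_bool b = (0::nat)} = {False}"
    "{b. of_bool b \<noteq> (1::nat)} = {False}"
    by (auto simp: of_bool_def split: if_splits)
  show "measure_pmf.prob (random_game n p) {g. game_value n g = 1} = win_prob p n"
    "measure_pmf.prob (random_game n p) {g. game_value n g = 0} = 1 - win_prob p n"
    "measure_pmf.prob (random_game n p) {g. game_value n g \<noteq> 1} = 1 - win_prob p n"
    using win_prob_range[OF assms, of n]
    by (simp_all only: *[of "\<lambda>v. v = 1"] *[of "\<lambda>v. v = 0"] *[of "\<lambda>v. v \<noteq> 1"] sets
      measure_pmf_single) simp_all
qed

section \<open>The two-level recursion\<close>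

lemma golden_section_square:
  fixes \<phi> :: real
  assumes "\<phi> = (sqrt 5 - 1) / 2"
  shows "\<phi>\<^sup>2 + \<phi> = 1"
proof -
  \<comment> \<open>Completing the square: \<open>2 * \<phi> + 1\<close> is
    \<open>sqrt 5\<close>.\<close>
  have "(2 * \<phi> + 1)\<^sup>2 = 5"
    by (simp add: assms diff_divide_distrib)
  then show ?thesis
    by (simp add: power2_eq_square algebra_simps)
qed

lemma golden_section_range:
  fixes \<phi> :: real
  assumes "\<phi> = (sqrt 5 - 1) / 2"
  shows "0 < \<phi>" "\<phi> < 1"
proof -
  have "1 < sqrt (5::real)" by (rule real_less_rsqrt) auto
  moreover have "sqrt 5 < (3::real)" by (rule real_less_lsqrt) auto
  ultimately show "0 < \<phi>" "\<phi> < 1" unfolding assms by simp_all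
qed

text \<open>The roots sum to -1, so the second one is \<open>- \<phi> - 1\<close>. For positive
  \<phi> it is negative, and on the unit interval the sign is that of
  \<open>x - \<phi>\<close>.\<close>

lemma quadratic_golden_section_factor:
  fixes x \<phi> :: real
  assumes "\<phi>\<^sup>2 + \<phi> = 1"
  shows "x\<^sup>2 + x - 1 = (x - \<phi>) * (x + \<phi> + 1)"
  using assms by (simp add: power2_eq_square algebra_simps)

lemma two_level_step_diff:
  fixes x \<phi> :: real
  assumes "\<phi>\<^sup>2 + \<phi> = 1"
  shows "1 - (1 - x\<^sup>2)\<^sup>2 - x = x * (1 - x) * ((x - \<phi>) * (x + \<phi> + 1))"
  unfolding quadratic_golden_section_factor[OF assms, symmetric]
  by (simp add: power2_eq_square algebra_simps)

section \<open>Orbits of the two-level map\<close>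

context
  fixes x :: "nat \<Rightarrow> real" and \<phi> :: real
  assumes golden: "\<phi>\<^sup>2 + \<phi> = 1" and \<phi>: "0 < \<phi>" "\<phi> < 1"
    and unit: "\<And>n. x n \<in> {0..1}"
    and step: "\<And>n. x (Suc n) = 1 - (1 - (x n)\<^sup>2)\<^sup>2"
begin

lemma two_level_orbit_diff: "x (Suc n) - x n = x n * (1 - x n) * ((x n - \<phi>) * (x n + \<phi> + 1))"
  unfolding step by (rule two_level_step_diff[OF golden])

text \<open>By continuity the limit is a fixed point.\<close>

lemma two_level_orbit_limit:
  assumes "x \<longlonglongrightarrow> L"
  shows "L = 0 \<or> L = 1 \<or> L = \<phi>"
proof -
  have "(\<lambda>n. 1 - (1 - (x n)\<^sup>2)\<^sup>2) \<longlonglongrightarrow> 1 - (1 - L\<^sup>2)\<^sup>2"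
    by (intro tendsto_intros assms)
  moreover have "(\<lambda>n. x (Suc n)) \<longlonglongrightarrow> L"
    using assms by (rule LIMSEQ_Suc)
  ultimately have "L = 1 - (1 - L\<^sup>2)\<^sup>2"
    unfolding step using LIMSEQ_unique by blast
  then have "L * (1 - L) * ((L - \<phi>) * (L + \<phi> + 1)) = 0"
    using two_level_step_diff[OF golden, of L] by simp
  \<comment> \<open>This excludes the fourth root \<open>- \<phi> - 1\<close>.\<close>
  moreover have "0 \<le> L"
    using LIMSEQ_le_const[OF assms, of 0] unit by auto
  ultimately show ?thesis
    using \<phi> by auto
qed

text \<open>The orbit increases and is bounded by 1, so it converges; its limit is at least
  \<open>x 0\<close>, hence above \<phi>, where 1 is the only fixed point left.\<close>

lemma two_level_orbit_above:
  assumes "\<phi> < x 0"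
  shows "x \<longlonglongrightarrow> 1"
proof -
  have grow: "x n \<le> x (Suc n)" if "\<phi> < x n" for n
  proof -
    have "0 \<le> x n * (1 - x n) * ((x n - \<phi>) * (x n + \<phi> + 1))"
      using that unit[of n] \<phi> by (intro mult_nonneg_nonneg) auto
    then show ?thesis using two_level_orbit_diff[of n] by simp
  qed
  have above: "\<phi> < x n" for n
    using assms grow by (induction n) (auto intro: less_le_trans)
  have "incseq x"
    using grow above by (auto intro: incseq_SucI)
  then obtain L where L: "x \<longlonglongrightarrow> L" "\<And>n. x n \<le> L"
    using incseq_convergent[of x 1] unit by auto
  have "\<phi> < L" using assms L(2)[of 0] by simp
  then have "L = 1" using two_level_orbit_limit[OF L(1)] \<phi> by auto
  then show ?thesis using L(1) by simp
qed

text \<open>Symmetrically, the orbit decreases to a limit below \<phi>, which can only be 0.\<close>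

lemma two_level_orbit_below:
  assumes "x 0 < \<phi>"
  shows "x \<longlonglongrightarrow> 0"
proof -
  have shrink: "x (Suc n) \<le> x n" if "x n < \<phi>" for n
  proof -
    have "0 \<le> x n * (1 - x n) * ((\<phi> - x n) * (x n + \<phi> + 1))"
      using that unit[of n] \<phi> by (intro mult_nonneg_nonneg) auto
    also have "\<dots> = - (x (Suc n) - x n)"
      unfolding two_level_orbit_diff by (simp add: algebra_simps)
    finally show ?thesis by simp
  qed
  have below: "x n < \<phi>" for n
    using assms shrink by (induction n) (auto intro: le_less_trans)
  have "decseq x"
    using shrink below by (auto intro: decseq_SucI)
  then obtain L where L: "x \<longlonglongrightarrow> L" "\<And>n. L \<le> x n"
    using decseq_convergent[of x 0] unit by auto
  have "L < \<phi>" using assms L(2)[of 0] by simp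
  then have "L = 0" using two_level_orbit_limit[OF L(1)] \<phi> by auto
  then show ?thesis using L(1) by simp
qed

end

text \<open>Each odd-indexed term is the square of the preceding even-indexed one, so both
  subsequences share the limit when L is 0 or 1.\<close>

lemma win_prob_tendsto:
  assumes "(\<lambda>n. win_prob p (2 * n)) \<longlonglongrightarrow> L" "L\<^sup>2 = L"
  shows "win_prob p \<longlonglongrightarrow> L"
proof (rule limseq_even_odd)
  show "(\<lambda>n. win_prob p (2 * n + 1)) \<longlonglongrightarrow> L"
    using tendsto_power[OF assms(1), of 2] assms(2) by simp
qed (rule assms(1))

text \<open>Squaring sends \<phi> to \<open>1 - \<phi>\<close>, and Player 1's step sends this back
  to \<open>1 - \<phi>\<^sup>2 = \<phi>\<close>: a cycle of period two.\<close>

lemma win_prob_golden_section: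
  assumes "\<phi>\<^sup>2 + \<phi> = 1"
  shows "win_prob \<phi> n = (if even n then \<phi> else 1 - \<phi>)"
  using assms by (induction n) (auto simp: algebra_simps)

theorem proposition1:
  fixes p \<phi> :: real
  assumes "p \<in> {0..1}"
    and "\<phi> = (sqrt 5 - 1) / 2"
  shows "(p > \<phi> \<longrightarrow>
            (\<lambda>n. measure_pmf.prob (random_game n p) {g. game_value n g = 1}) \<longlonglongrightarrow> 1)
       \<and> (p < \<phi> \<longrightarrow>
            (\<lambda>n. measure_pmf.prob (random_game n p) {g. game_value n g = 0}) \<longlonglongrightarrow> 1)
       \<and> (p = \<phi> \<longrightarrow>
            (\<forall>n. measure_pmf.prob (random_game n p) {g. winner n g = starting_player n} = \<phi>)
          \<and> (\<forall>n. measure_pmf.prob (random_game (2 * n) p) {g. game_value (2 * n) g = 1} = \<phi>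
                \<and> measure_pmf.prob (random_game (2 * n + 1) p) {g. game_value (2 * n + 1) g = 0} = \<phi>))"
proof (intro conjI impI allI)
  note golden = golden_section_square[OF assms(2)]
  note \<phi> = golden_section_range[OF assms(2)]
  note prob = prob_game_value[OF assms(1)]
  let ?x = "\<lambda>n. win_prob p (2 * n)"
  have unit: "?x n \<in> {0..1}" for n
    by (rule win_prob_range[OF assms(1)])
  \<comment> \<open>Going from depth \<open>2 * n\<close> to \<open>2 * n + 2\<close> adds a level
    of Player 2, then one of Player 1.\<close>
  have step: "?x (Suc n) = 1 - (1 - (?x n)\<^sup>2)\<^sup>2" for n
    by simp
  show "(\<lambda>n. measure_pmf.prob (random_game n p) {g. game_value n g = 1}) \<longlonglongrightarrow> 1" if "\<phi> < p"
    unfolding prob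
    using two_level_orbit_above[of \<phi> ?x, OF golden \<phi> unit step] that by (simp add: win_prob_tendsto)
  show "(\<lambda>n. measure_pmf.prob (random_game n p) {g. game_value n g = 0}) \<longlonglongrightarrow> 1" if "p < \<phi>"
  proof -
    have "win_prob p \<longlonglongrightarrow> 0"
      using two_level_orbit_below[of \<phi> ?x, OF golden \<phi> unit step] that by (simp add: win_prob_tendsto)
    from tendsto_diff[OF tendsto_const[of 1] this] show ?thesis
      unfolding prob by simp
  qed
  fix n
  assume "p = \<phi>"
  then have win: "win_prob p m = (if even m then \<phi> else 1 - \<phi>)" for m
    using win_prob_golden_section[OF golden] by simp
  show "measure_pmf.prob (random_game n p) {g. winner n g = starting_player n} = \<phi>"
  proof (cases "even n")
    case True
    then have "{g. winner n g = starting_player n} = {g. game_value n g = 1}"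
      by (auto simp: winner_def starting_player_def mover_def)
    with True show ?thesis by (simp only: prob win if_True)
  next
    case False
    \<comment> \<open>At odd depth Player 2 starts, and wins with probability
      \<open>1 - (1 - \<phi>)\<close>.\<close>
    then have "{g. winner n g = starting_player n} = {g. game_value n g \<noteq> 1}"
      by (auto simp: winner_def starting_player_def mover_def)
    with False show ?thesis by (simp only: prob win if_False)
  qed
  show "measure_pmf.prob (random_game (2 * n) p) {g. game_value (2 * n) g = 1} = \<phi>"
    by (simp only: prob win) simp
  show "measure_pmf.prob (random_game (2 * n + 1) p) {g. game_value (2 * n + 1) g = 0} = \<phi>"
    by (simp only: prob win) simp
qed

end
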